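(* Let $\mathcal{A}$ be a finite alphabet with $\mathrm{Card}(\mathcal{A})=q\ge 2$, and let $k\ge 1$ and $N$ be integers. If $q^k+k<N<q^{k+1}+k+1$, then $R(N)=\{k+1\}$. If $N=q^k+k$, then $R(N)=\{k,k+1\}$.
   Context: $\mathcal{A}^n$ denotes the set of words of length $n$ over $\mathcal{A}$, i.e. finite sequences $w=w_1w_2\ldots w_n$ of letters of $\mathcal{A}$. A word $u$ is a factor (or subword) of $w$ if there exist (possibly empty) words $x,y$ over $\mathcal{A}$ with $w=xuy$ (so factors are contiguous). $F_n(w)$ is the set of all factors of $w$ of length $n$. The subword complexity of $w$ is $f_w(n)=\mathrm{Card}(F_n(w))$ for $1\le n\le |w|$ (and $f_w(n)=0$ for $n>|w|$). The maximal complexity of $w$ is $C(w)=\max\{f_w(n) : n\ge 1\}$. The global maximal complexity in $\mathcal{A}^N$ is $K(N)=\max\{C(w) : w\in\mathcal{A}^N\}$. Finally, $R(N)=\{i\in\{1,2,\ldots,N\} : \text{there exists } w\in\mathcal{A}^N \text{ with } f_w(i)=K(N)\}$. *)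

theory Defs
  imports "HOL-Library.Sublist" "HOL-Library.NList"
begin

definition factors :: "nat \<Rightarrow> 'a list \<Rightarrow> 'a list set" where
  "factors n w = {u. sublist u w \<and> length u = n}"

definition subword_complexity :: "'a list \<Rightarrow> nat \<Rightarrow> nat" where
  "subword_complexity w n = card (factors n w)"

lemma finite_factors: "finite (factors n w)"
  by (rule finite_subset[OF _ finite_lists_length_eq[of "set w" n]])
     (auto simp: factors_def sublist_def)

lemma subword_complexity_eq_0: "length w < n \<Longrightarrow> subword_complexity w n = 0"
proof -
  assume "length w < n"
  then have "factors n w = {}"
    unfolding factors_def by (fastforce simp: sublist_def)
  then show ?thesis by (simp add: subword_complexity_def)
qed

definition max_complexity :: "'a list \<Rightarrow> nat" where
  "max_complexity w = Max {subword_complexity w n | n. n \<ge> 1}"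

text \<open>Both \<^const>\<open>Max\<close>es here range over finite nonempty sets (for a finite nonempty alphabet), so they are genuine maxima.\<close>

lemma finite_complexity_values: "finite {subword_complexity w n | n. n \<ge> 1}"
proof (rule finite_subset)
  show "{subword_complexity w n | n. n \<ge> 1} \<subseteq> insert 0 (subword_complexity w ` {..length w})"
  proof
    fix x
    assume "x \<in> {subword_complexity w n | n. n \<ge> 1}"
    then obtain n where x: "x = subword_complexity w n" by blast
    show "x \<in> insert 0 (subword_complexity w ` {..length w})"
    proof (cases "n \<le> length w")
      case True
      then show ?thesis unfolding x by blast
    next
      case False
      then have "x = 0" unfolding x by (intro subword_complexity_eq_0) simp
      then show ?thesis by blast
    qed
  qed
qed simp

definition global_max_complexity :: "'a set \<Rightarrow> nat \<Rightarrow> nat" where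
  "global_max_complexity A N = Max {max_complexity w | w. w \<in> nlists N A}"

lemma finite_max_complexity_values:
  "finite A \<Longrightarrow> finite {max_complexity w | w. w \<in> nlists N A}"
proof -
  assume "finite A"
  then have "finite (nlists N A)"
    by (intro finite_subset[OF _ finite_lists_length_eq[of A N]]) (auto simp only: nlists_def)
  moreover have "{max_complexity w | w. w \<in> nlists N A} = max_complexity ` nlists N A"
    by (rule Setcompr_eq_image)
  ultimately show ?thesis by (simp only: finite_imageI)
qed

lemma max_complexity_values_nonempty:
  "A \<noteq> {} \<Longrightarrow> {max_complexity w | w. w \<in> nlists N A} \<noteq> {}"
proof -
  assume "A \<noteq> {}"
  then obtain a where "a \<in> A" by blast
  then have "replicate N a \<in> nlists N A" by (intro nlistsI) auto
  then show ?thesis by blast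
qed

definition max_complexity_lengths :: "'a set \<Rightarrow> nat \<Rightarrow> nat set" where
  "max_complexity_lengths A N =
     {i \<in> {1..N}. \<exists>w \<in> nlists N A. subword_complexity w i = global_max_complexity A N}"

end

theory Submission
  imports Defs
begin

text \<open>
  A word of length \<open>N\<close> has at most \<open>min (q ^ n) (N + 1 - n)\<close> factors of length \<open>n\<close>, so everything
  follows once this bound is attained, and for that it suffices to have de Bruijn words of every
  order \<open>n\<close>: their prefixes have pairwise distinct factors of length \<open>n\<close>. De Bruijn words come from
  Martin's greedy construction: start with \<open>n - 1\<close> copies of a letter \<open>z\<close> and keep appending letters
  that create a new factor of length \<open>n\<close>, using \<open>z\<close> only as a last resort. When this stops, the last
  \<open>n - 1\<close> letters have all their right extensions, which forces them to be the initial block of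
  \<open>z\<close>s; hence each word of length \<open>n - 1\<close> has as many left as right extensions. So if \<open>x u\<close> is missing,
  then some right extension of \<open>u\<close> is missing, and therefore \<open>u z\<close> is. Iterating, the power of \<open>z\<close> of
  length \<open>n\<close> is missing, a contradiction.
\<close>

section \<open>Factors as windows, and the two upper bounds on complexity\<close>

lemma factors_eq_image:
  assumes "d \<le> length w"
  shows "factors (Suc d) w = (\<lambda>p. take (Suc d) (drop p w)) ` {..<length w - d}"
proof (intro equalityI subsetI)
  fix u assume "u \<in> factors (Suc d) w"
  then obtain xs ys where w: "w = xs @ u @ ys" and u: "length u = Suc d"
    by (auto simp: factors_def sublist_def)
  have "u = take (Suc d) (drop (length xs) w)" "length xs < length w - d"
    using w u by auto
  then show "u \<in> (\<lambda>p. take (Suc d) (drop p w)) ` {..<length w - d}" by blast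
next
  fix u assume "u \<in> (\<lambda>p. take (Suc d) (drop p w)) ` {..<length w - d}"
  then obtain p where p: "p < length w - d" and u: "u = take (Suc d) (drop p w)" by auto
  have "w = take p w @ u @ drop (Suc d) (drop p w)"
    unfolding u by (simp only: append_take_drop_id)
  then have "sublist u w" unfolding sublist_def by blast
  then show "u \<in> factors (Suc d) w" using p u by (simp add: factors_def)
qed

lemma factors_snoc:
  assumes "d \<le> length w"
  shows "factors (Suc d) (w @ [a]) =
    insert (drop (length w - d) w @ [a]) (factors (Suc d) w)"
proof -
  have eq: "{..<length (w @ [a]) - d} = insert (length w - d) {..<length w - d}"
    using assms by auto
  have "(\<lambda>p. take (Suc d) (drop p (w @ [a]))) ` {..<length w - d} =
      (\<lambda>p. take (Suc d) (drop p w)) ` {..<length w - d}"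
    by (intro image_cong) auto
  moreover have "take (Suc d) (drop (length w - d) (w @ [a])) = drop (length w - d) w @ [a]"
    using assms by simp
  moreover have "factors (Suc d) (w @ [a]) =
      (\<lambda>p. take (Suc d) (drop p (w @ [a]))) ` {..<length (w @ [a]) - d}"
    using assms by (intro factors_eq_image) simp
  ultimately show ?thesis
    unfolding factors_eq_image[OF assms] eq image_insert by simp
qed

lemma factors_subset_words: "set w \<subseteq> A \<Longrightarrow> factors n w \<subseteq> {u. set u \<subseteq> A \<and> length u = n}"
  by (auto simp: factors_def dest: set_mono_sublist)

lemma subword_complexity_le_power:
  assumes "finite A" "set w \<subseteq> A"
  shows "subword_complexity w n \<le> card A ^ n"
  using card_mono[OF finite_lists_length_eq factors_subset_words] assms
  by (metis card_lists_length_eq subword_complexity_def)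

lemma subword_complexity_le_length:
  assumes "n \<ge> 1"
  shows "subword_complexity w n \<le> length w + 1 - n"
proof (cases "n \<le> length w")
  case True
  then obtain d where n: "n = Suc d" "d \<le> length w" using assms by (cases n) auto
  then show ?thesis
    using card_image_le[of "{..<length w - d}" "\<lambda>p. take (Suc d) (drop p w)"]
    by (simp add: subword_complexity_def factors_eq_image)
qed (simp add: subword_complexity_eq_0)

section \<open>Greedy words and the extensions of their factors\<close>

text \<open>Both sides count the \<open>p \<le> M\<close> with \<open>f p = u\<close>, splitting off
  the last index on the left and the first on the right. Applied to windows, this compares
  occurrences of \<open>u\<close> that have a next letter with those that have a previous
  one.\<close>

lemma card_window_balance:
  fixes f :: "nat \<Rightarrow> 'b"
  shows "card {p. p < M \<and> f p = u} + of_bool (f M = u) =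
    card {p. p < M \<and> f (Suc p) = u} + of_bool (f 0 = u)"
proof (induction M)
  case (Suc M)
  have split: "card {p. p < Suc M \<and> P p} = card {p. p < M \<and> P p} + of_bool (P M)" for P
  proof -
    have "{p. p < Suc M \<and> P p} = {p. p < M \<and> P p} \<union> (if P M then {M} else {})"
      by (auto simp: less_Suc_eq)
    then show ?thesis by simp
  qed
  show ?case using Suc by (simp only: split)
qed simp

text \<open>The last condition is all that is needed of the rule that \<open>z\<close> is appended only as a last
  resort; the order in which the letters were appended does not matter.\<close>

definition greedy_word :: "'a set \<Rightarrow> 'a \<Rightarrow> nat \<Rightarrow> 'a list \<Rightarrow> bool" where
  "greedy_word A z d w \<longleftrightarrow> set w \<subseteq> A \<and> d \<le> length w \<and> take d w = replicate d z \<and>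
    subword_complexity w (Suc d) = length w - d \<and>
    (\<forall>u. u @ [z] \<in> factors (Suc d) w \<longrightarrow> (\<forall>a\<in>A. u @ [a] \<in> factors (Suc d) w))"

text \<open>The set of factors only grows, so closure under replacing a final \<open>z\<close> can
  fail only at the new factor, and only if that factor ends in \<open>z\<close>.\<close>

lemma greedy_word_snoc:
  assumes w: "greedy_word A z d w" and a: "a \<in> A"
    and new: "drop (length w - d) w @ [a] \<notin> factors (Suc d) w"
    and last_resort: "a = z \<Longrightarrow> \<forall>b\<in>A - {z}. drop (length w - d) w @ [b] \<in> factors (Suc d) w"
  shows "greedy_word A z d (w @ [a])"
proof -
  have d: "d \<le> length w" using w by (simp add: greedy_word_def)
  have "subword_complexity (w @ [a]) (Suc d) = Suc (subword_complexity w (Suc d))"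
    using new by (simp add: subword_complexity_def factors_snoc[OF d] finite_factors)
  then show ?thesis
    using w a d last_resort by (auto simp: greedy_word_def factors_snoc[OF d])
qed

text \<open>The windows of a greedy word are distinct, so their number, and with it the length of
  the word, is bounded by the number of words of length \<open>Suc d\<close>. A longest greedy word
  therefore exists.\<close>

lemma ex_maximal_greedy_word:
  assumes "finite A" "z \<in> A"
  obtains w where "greedy_word A z d w" "\<And>a. \<not> greedy_word A z d (w @ [a])"
proof -
  have "factors (Suc d) (replicate d z) = {}"
    by (simp add: factors_eq_image)
  then have init: "greedy_word A z d (replicate d z)"
    using assms by (auto simp: greedy_word_def subword_complexity_def)
  have bound: "length w \<le> card A ^ Suc d + d" if "greedy_word A z d w" for w
    using that subword_complexity_le_power[OF assms(1), of w "Suc d"]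
    by (simp add: greedy_word_def del: power_Suc)
  have "\<exists>w. greedy_word A z d w \<and> (\<forall>v. greedy_word A z d v \<longrightarrow> length v \<le> length w)"
    using ex_has_greatest_nat[of "greedy_word A z d" _ length] init le_imp_less_Suc[OF bound]
    by blast
  then obtain w where w: "greedy_word A z d w"
    and max: "\<forall>v. greedy_word A z d v \<longrightarrow> length v \<le> length w" by blast
  have "\<not> greedy_word A z d (w @ [a])" for a
    using spec[OF max, of "w @ [a]"] by simp
  then show thesis using that w by blast
qed

text \<open>Maximal complexity makes every factor of length \<open>Suc d\<close> occur exactly once,
  so extensions of \<open>u\<close> can be counted as occurrences of \<open>u\<close>. The final
  occurrence has no right extension and the initial one no left extension, whence the two
  corrections.\<close>

lemma card_extensions:
  assumes w: "set w \<subseteq> A" "d \<le> length w"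
    and complexity: "subword_complexity w (Suc d) = length w - d"
  shows "card {a \<in> A. u @ [a] \<in> factors (Suc d) w} + of_bool (drop (length w - d) w = u) =
    card {a \<in> A. a # u \<in> factors (Suc d) w} + of_bool (take d w = u)"
proof -
  define M where "M = length w - d"
  define v where "v p = take d (drop p w)" for p
  define e where "e p = take (Suc d) (drop p w)" for p
  have F: "factors (Suc d) w = e ` {..<M}"
    unfolding e_def M_def using w(2) by (rule factors_eq_image)
  have inj: "inj_on e {..<M}"
    using complexity by (intro eq_card_imp_inj_on) (auto simp: subword_complexity_def F M_def)
  have snoc: "e p = v p @ [w ! (p + d)]" "w ! (p + d) \<in> A" if "p < M" for p
    using that w by (auto simp: e_def v_def M_def take_Suc_conv_app_nth)
  have Cons: "e p = w ! p # v (Suc p)" "w ! p \<in> A" if "p < M" for p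
  proof -
    have p: "p < length w" using that by (simp add: M_def)
    show "e p = w ! p # v (Suc p)"
      unfolding e_def v_def using Cons_nth_drop_Suc[OF p] by (metis take_Suc_Cons)
    show "w ! p \<in> A" using p w by auto
  qed
  \<comment> \<open>Letters in \<open>S\<close> and positions in \<open>P\<close> are compared
    through the set of factors that both parametrize injectively.\<close>
  have card_eq: "card S = card P"
    if "inj_on g S" "P \<subseteq> {..<M}" "g ` S = e ` P" for g :: "'a \<Rightarrow> 'a list" and S P
    using that card_image[OF that(1)] card_image[OF inj_on_subset[OF inj that(2)]] by simp
  have right: "card {a \<in> A. u @ [a] \<in> factors (Suc d) w} = card {p. p < M \<and> v p = u}"
  proof (rule card_eq)
    show "(\<lambda>a. u @ [a]) ` {a \<in> A. u @ [a] \<in> factors (Suc d) w} = e ` {p. p < M \<and> v p = u}"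
      (is "?L = ?R")
    proof (intro equalityI subsetI)
      fix s assume "s \<in> ?L"
      then obtain a p where "s = u @ [a]" "p < M" "s = e p" unfolding F by blast
      moreover from this have "v p = u" using snoc(1)[of p] by simp
      ultimately show "s \<in> ?R" by blast
    next
      fix s assume "s \<in> ?R"
      then obtain p where "s = e p" "p < M" "v p = u" by blast
      then have "s \<in> factors (Suc d) w" "s = u @ [w ! (p + d)]" "w ! (p + d) \<in> A"
        using snoc[of p] unfolding F by blast+
      then show "s \<in> ?L" by blast
    qed
  qed (auto simp: inj_on_def)
  have left: "card {a \<in> A. a # u \<in> factors (Suc d) w} = card {p. p < M \<and> v (Suc p) = u}"
  proof (rule card_eq)
    show "(\<lambda>a. a # u) ` {a \<in> A. a # u \<in> factors (Suc d) w} = e ` {p. p < M \<and> v (Suc p) = u}"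
      (is "?L = ?R")
    proof (intro equalityI subsetI)
      fix s assume "s \<in> ?L"
      then obtain a p where "s = a # u" "p < M" "s = e p" unfolding F by blast
      moreover from this have "v (Suc p) = u" using Cons(1)[of p] by simp
      ultimately show "s \<in> ?R" by blast
    next
      fix s assume "s \<in> ?R"
      then obtain p where "s = e p" "p < M" "v (Suc p) = u" by blast
      then have "s \<in> factors (Suc d) w" "s = w ! p # u" "w ! p \<in> A"
        using Cons[of p] unfolding F by blast+
      then show "s \<in> ?L" by blast
    qed
  qed (auto simp: inj_on_def)
  have "v M = drop (length w - d) w" "v 0 = take d w"
    using w(2) by (auto simp: v_def M_def)
  then show ?thesis
    using card_window_balance[of M v u] left right by simp
qed

section \<open>De Bruijn words and words attaining the upper bounds\<close>

lemma ex_de_bruijn_word: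
  assumes "finite A" "A \<noteq> {}"
  obtains w where "set w \<subseteq> A" "length w = card A ^ Suc d + d"
    "factors (Suc d) w = {u. set u \<subseteq> A \<and> length u = Suc d}"
proof -
  obtain z where z: "z \<in> A" using assms by blast
  obtain w where w: "greedy_word A z d w" and max: "\<And>a. \<not> greedy_word A z d (w @ [a])"
    using ex_maximal_greedy_word[OF assms(1) z] by metis
  let ?F = "factors (Suc d) w" and ?end = "drop (length w - d) w"
  have wA: "set w \<subseteq> A" and d: "d \<le> length w" and start: "take d w = replicate d z"
    and complexity: "subword_complexity w (Suc d) = length w - d"
    and greedy: "\<And>u a. u @ [z] \<in> ?F \<Longrightarrow> a \<in> A \<Longrightarrow> u @ [a] \<in> ?F"
    using w by (auto simp: greedy_word_def)
  note balance = card_extensions[OF wA d complexity]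
  \<comment> \<open>A missing extension by a letter other than \<open>z\<close> could be appended at
    once; when none is missing, \<open>z\<close> itself would be admissible.\<close>
  have stuck: "?end @ [a] \<in> ?F" if "a \<in> A" for a
    using greedy_word_snoc[OF w] max z that by (metis DiffD1 DiffD2 singletonI)
  have "{a \<in> A. ?end @ [a] \<in> ?F} = A" using stuck by blast
  moreover have "card {a \<in> A. a # ?end \<in> ?F} \<le> card A"
    using assms(1) by (intro card_mono) auto
  \<comment> \<open>For \<open>u = ?end\<close> the left side of the balance is
    \<open>card A + 1\<close>, which the right side reaches only if its \<open>of_bool\<close> term
    is 1.\<close>
  ultimately have closed: "take d w = ?end"
    using balance[of ?end] by (auto simp: of_bool_def split: if_splits)
  have shift: "u @ [z] \<notin> ?F" if "x \<in> A" "x # u \<notin> ?F" for x u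
  proof
    assume "u @ [z] \<in> ?F"
    then have "{a \<in> A. u @ [a] \<in> ?F} = A" using greedy by blast
    \<comment> \<open>By \<open>closed\<close> the two \<open>of_bool\<close> terms cancel for every
      \<open>u\<close>.\<close>
    then have "card {a \<in> A. a # u \<in> ?F} = card A"
      using balance[of u] closed by simp
    then have "{a \<in> A. a # u \<in> ?F} = A"
      using assms(1) by (intro card_subset_eq) auto
    then show False using that by blast
  qed
  have "s \<in> ?F" if s: "set s \<subseteq> A" "length s = Suc d" for s
  proof (rule ccontr)
    assume "s \<notin> ?F"
    have "drop j s @ replicate j z \<notin> ?F" if "j \<le> Suc d" for j
      using that
    proof (induction j)
      case 0
      then show ?case using \<open>s \<notin> ?F\<close> by simp
    next
      case (Suc j)
      then have j: "j < length s" using s by simp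
      then have "s ! j \<in> A" using s by auto
      moreover have "s ! j # drop (Suc j) s @ replicate j z \<notin> ?F"
        using Suc Cons_nth_drop_Suc[OF j] by (metis Suc_leD append_Cons)
      ultimately show ?case
        using shift by (metis append.assoc replicate_append_same replicate_Suc)
    qed
    \<comment> \<open>After \<open>Suc d\<close> shifts no letter of \<open>s\<close> is left; the
      resulting power of \<open>z\<close> is \<open>?end @ [z]\<close>, which \<open>stuck\<close>
      puts into \<open>?F\<close>.\<close>
    from this[of "Suc d"] have "replicate d z @ [z] \<notin> ?F"
      using s by (simp add: replicate_append_same)
    then show False using stuck[OF z] closed start by simp
  qed
  then have F: "?F = {u. set u \<subseteq> A \<and> length u = Suc d}"
    using factors_subset_words[OF wA] by blast
  then have "length w - d = card A ^ Suc d"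
    using complexity card_lists_length_eq[OF assms(1)] by (simp add: subword_complexity_def)
  then show thesis using that wA F d by force
qed

lemma ex_word_distinct_factors:
  assumes "finite A" "A \<noteq> {}" "d \<le> N" "N \<le> card A ^ Suc d + d"
  shows "\<exists>w \<in> nlists N A. subword_complexity w (Suc d) = N - d"
proof -
  obtain w where wA: "set w \<subseteq> A" and len: "length w = card A ^ Suc d + d"
    and F: "factors (Suc d) w = {u. set u \<subseteq> A \<and> length u = Suc d}"
    using ex_de_bruijn_word[OF assms(1,2)] .
  let ?e = "\<lambda>p. take (Suc d) (drop p w)"
  have "card (factors (Suc d) w) = length w - d"
    using F len card_lists_length_eq[OF assms(1)] by simp
  then have "inj_on ?e {..<length w - d}"
    using len by (intro eq_card_imp_inj_on) (simp_all add: factors_eq_image)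
  then have "inj_on ?e {..<N - d}"
    by (rule inj_on_subset) (use assms len in auto)
  moreover have "factors (Suc d) (take N w) = ?e ` {..<N - d}"
  proof -
    have "take (Suc d) (drop p (take N w)) = ?e p" if "p < N - d" for p
      using that by (simp add: drop_take min_def)
    then show ?thesis using assms len by (simp add: factors_eq_image)
  qed
  ultimately have "subword_complexity (take N w) (Suc d) = N - d"
    by (simp add: subword_complexity_def card_image)
  moreover have "take N w \<in> nlists N A"
    using assms len wA by (intro nlistsI) (auto dest: in_set_takeD)
  ultimately show ?thesis by blast
qed

text \<open>Padding a de Bruijn word on the right keeps all its factors, and no further ones of
  length \<open>Suc d\<close> exist over \<open>A\<close>.\<close>

lemma ex_word_all_factors:
  assumes "finite A" "A \<noteq> {}" "N \<ge> card A ^ Suc d + d"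
  shows "\<exists>w \<in> nlists N A. subword_complexity w (Suc d) = card A ^ Suc d"
proof -
  obtain z where z: "z \<in> A" using assms by blast
  obtain w where wA: "set w \<subseteq> A" and len: "length w = card A ^ Suc d + d"
    and F: "factors (Suc d) w = {u. set u \<subseteq> A \<and> length u = Suc d}"
    using ex_de_bruijn_word[OF assms(1,2)] .
  define w' where "w' = w @ replicate (N - length w) z"
  have w': "set w' \<subseteq> A" using wA z by (auto simp: w'_def)
  have "factors (Suc d) w \<subseteq> factors (Suc d) w'"
    by (auto simp: factors_def w'_def sublist_append)
  then have "factors (Suc d) w' = {u. set u \<subseteq> A \<and> length u = Suc d}"
    using F factors_subset_words[OF w'] by blast
  then have "subword_complexity w' (Suc d) = card A ^ Suc d"
    using card_lists_length_eq[OF assms(1)] by (simp add: subword_complexity_def)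
  moreover have "w' \<in> nlists N A"
    using assms(3) len w' by (intro nlistsI) (auto simp: w'_def)
  ultimately show ?thesis by blast
qed

section \<open>The global maximum and the lengths that attain it\<close>

lemma global_max_complexity_eqI:
  assumes "finite A" and w: "w \<in> nlists N A" "n \<ge> 1" "subword_complexity w n = m"
    and le: "\<And>v i. v \<in> nlists N A \<Longrightarrow> i \<ge> 1 \<Longrightarrow> subword_complexity v i \<le> m"
  shows "global_max_complexity A N = m"
proof -
  have max_le: "max_complexity v \<le> m" if "v \<in> nlists N A" for v
    unfolding max_complexity_def
    using le[OF that] by (subst Max_le_iff[OF finite_complexity_values]) auto
  have "m \<le> max_complexity w"
    unfolding max_complexity_def using w by (intro Max_ge[OF finite_complexity_values]) blast
  then have "max_complexity w = m" using max_le[OF w(1)] by simp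
  then show ?thesis
    unfolding global_max_complexity_def
    using max_le w(1) finite_max_complexity_values[OF assms(1)] by (intro Max_eqI) auto
qed

theorem proposition2:
  fixes A :: "'a set" and q k N :: nat
  assumes "finite A" and "card A = q" and "q \<ge> 2" and "k \<ge> 1"
  shows "(q ^ k + k < N \<and> N < q ^ (k + 1) + k + 1 \<longrightarrow> max_complexity_lengths A N = {k + 1}) \<and>
         (N = q ^ k + k \<longrightarrow> max_complexity_lengths A N = {k, k + 1})"
proof -
  have A: "A \<noteq> {}" using assms(2,3) by force
  have le_power: "subword_complexity v i \<le> q ^ i" if "v \<in> nlists N A" for v i
    using subword_complexity_le_power[OF assms(1) nlistsE_set[OF that], of i] assms(2) by simp
  have le_length: "subword_complexity v i \<le> N + 1 - i" if "v \<in> nlists N A" "i \<ge> 1" for v i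
    using subword_complexity_le_length[OF that(2), of v] nlistsE_length[OF that(1)] by simp
  have K: "global_max_complexity A N = N - k"
    and attained: "\<exists>w \<in> nlists N A. subword_complexity w (k + 1) = N - k"
    if N: "q ^ k + k \<le> N" "N \<le> q ^ (k + 1) + k"
  proof -
    show ex: "\<exists>w \<in> nlists N A. subword_complexity w (k + 1) = N - k"
      using ex_word_distinct_factors[OF assms(1) A, of k N] assms(2) N by simp
    \<comment> \<open>Lengths up to \<open>k\<close> are controlled by the number of words, larger
      ones by the number of windows.\<close>
    have "subword_complexity v i \<le> N - k" if v: "v \<in> nlists N A" "i \<ge> 1" for v i
    proof (cases "i \<le> k")
      case True
      then have "q ^ i \<le> q ^ k" using assms(3) by (intro power_increasing) auto
      then show ?thesis using le_power[OF v(1), of i] N by linarith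
    next
      case False
      then show ?thesis using le_length[OF v] by linarith
    qed
    then show "global_max_complexity A N = N - k"
      using ex global_max_complexity_eqI[OF assms(1)] by (metis le_add2)
  qed
  have only: "i = k + 1 \<or> (i = k \<and> N = q ^ k + k)"
    if N: "q ^ k + k \<le> N" and v: "v \<in> nlists N A" "i \<ge> 1" "subword_complexity v i = N - k" for i v
  proof -
    \<comment> \<open>Positivity gives \<open>N > k\<close>, so the truncated difference
      \<open>N + 1 - i\<close> is strictly below \<open>N - k\<close> once
      \<open>i > k + 1\<close>.\<close>
    have q: "q ^ k > 0" using assms(3) by simp
    have "i \<le> k + 1"
      using le_length[OF v(1,2)] v(3) q N by linarith
    moreover have "\<not> i < k"
    proof
      assume "i < k"
      then have "q ^ i < q ^ k" using assms(3) by (intro power_strict_increasing) auto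
      then show False using le_power[OF v(1), of i] v(3) N by linarith
    qed
    moreover have "i = k \<Longrightarrow> N = q ^ k + k"
      using le_power[OF v(1), of i] v(3) N by simp
    ultimately show ?thesis by linarith
  qed
  have lengths_eq: "i \<in> max_complexity_lengths A N \<longleftrightarrow>
      i \<in> {1..N} \<and> (\<exists>w \<in> nlists N A. subword_complexity w i = N - k)"
    if "q ^ k + k \<le> N" "N \<le> q ^ (k + 1) + k" for i
    by (simp only: max_complexity_lengths_def K[OF that] mem_Collect_eq)
  have q: "1 \<le> q ^ k" "q ^ k \<le> q ^ (k + 1)" using assms(3) by simp_all
  have subset: "i = k + 1 \<or> (i = k \<and> N = q ^ k + k)"
    if "q ^ k + k \<le> N" "N \<le> q ^ (k + 1) + k" "i \<in> max_complexity_lengths A N" for i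
    using only[OF that(1)] lengths_eq[OF that(1,2), of i] that(3) by fastforce
  have k1: "k + 1 \<in> max_complexity_lengths A N"
    if "q ^ k + k \<le> N" "N \<le> q ^ (k + 1) + k"
    using lengths_eq[OF that, of "k + 1"] attained[OF that] that q by auto
  show ?thesis
  proof (intro conjI impI)
    assume "q ^ k + k < N \<and> N < q ^ (k + 1) + k + 1"
    then have N: "q ^ k + k \<le> N" "N \<le> q ^ (k + 1) + k" "N \<noteq> q ^ k + k" by linarith+
    show "max_complexity_lengths A N = {k + 1}"
      using subset[OF N(1,2)] k1[OF N(1,2)] N(3) by blast
  next
    assume N: "N = q ^ k + k"
    have bounds: "q ^ k + k \<le> N" "N \<le> q ^ (k + 1) + k" using N q by linarith+
    obtain d where d: "k = Suc d" using assms(4) by (cases k) auto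
    \<comment> \<open>Here \<open>N - k = q ^ k\<close>, so all words of length \<open>k\<close>
      must occur; a de Bruijn word of order \<open>k\<close> has length
      \<open>q ^ k + d = N - 1\<close>, leaving one letter of padding.\<close>
    have "\<exists>w \<in> nlists N A. subword_complexity w k = N - k"
      using ex_word_all_factors[OF assms(1) A, of d N] N d assms(2) by simp
    moreover have "k \<in> {1..N}" using assms(4) N by simp
    ultimately have "k \<in> max_complexity_lengths A N"
      using lengths_eq[OF bounds, of k] by blast
    then show "max_complexity_lengths A N = {k, k + 1}"
      using subset[OF bounds] k1[OF bounds] by blast
  qed
qed

end
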